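(* Let $\mathcal{R}$ be a terminating (constructor, orthogonal) TRS with constructors $\mathcal{C}$ and defined symbols $\mathcal{D}$. Define the assignment $\theta$ by: $\theta(\mathtt{c})=0$ for $\mathtt{c}\in\mathcal{C}$ of arity $0$; $\theta(\mathtt{c})(X_1,\dots,X_n)=\sum_{i=1}^nX_i+1$ for $\mathtt{c}\in\mathcal{C}$ of arity $n>0$; and $\theta(\mathtt{f})(X_1,\dots,X_n)=\bigl(\sum_{i=1}^nX_i+1\bigr)\times|\mathcal{R}|^{\mathsf{rc}_\mathcal{R}(\sum_{i=1}^nX_i+1)}$ for $\mathtt{f}\in\mathcal{D}$ of arity $n$. Then $\theta$ is a sup-interpretation of $\mathcal{R}$.
   Context: A constructor TRS consists of disjoint sets $\mathcal{C}$ and $\mathcal{D}$ of symbols with fixed arities, variables, and finitely many rules $l\to r$ with $l=\mathtt{f}(t_1,\dots,t_n)$, $\mathtt{f}\in\mathcal{D}$, $t_i$ built from constructors and variables, variables of $r$ occurring in $l$; TRS are assumed orthogonal. It is terminating if there is no infinite rewrite sequence. The size $|t|$ of a term is its number of symbols; $|\mathcal{R}|=\sum_{l\to r\in\mathcal{R}}(|l|+|r|)$. The derivational length $\mathsf{dl}(t)$ of a term $t$ is the maximal $n$ such that $t\to_\mathcal{R}^n s$ for some $s$. Basic terms are terms $\mathtt{f}(v_1,\dots,v_n)$ with $\mathtt{f}\in\mathcal{D}$ and $v_i$ closed constructor terms (values); $\mathsf{rc}_\mathcal{R}(n)=\max\{\mathsf{dl}(t)\mid t \text{ basic},\ |t|\leq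 n\}$. Assignments map symbols of arity $m$ to functions $\mathbb{N}^m\to\mathbb{N}$ and are extended homomorphically to terms. $[\![\mathtt{f}]\!](v_1,\dots,v_n)=v$ iff $\mathtt{f}(v_1,\dots,v_n)\to_\mathcal{R}^*v$ with $v$ a value, and $\mathtt{f}(v_1,\dots,v_n)\downarrow$ means such $v$ exists. A sup-interpretation is an assignment $\theta$ whose functions are nondecreasing in each argument, which is additive (each constructor of arity $n>0$ gets $X_1+\dots+X_n+k_c$ with $k_c\geq1$, $0$-ary constructors get $0$), and such that for all $\mathtt{f}\in\mathcal{D}$ and values $v_i$: $\mathtt{f}(v_1,\dots,v_m)\downarrow\implies\theta(\mathtt{f}(v_1,\dots,v_m))\geq\theta([\![\mathtt{f}]\!](v_1,\dots,v_m))$.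
   Formalization: The size of a term does not count 0-ary constructors (all other symbols and variables count 1), also in |R| and rc_R; if they counted 1 the claim would fail, e.g. for g→c, f(c)→d(d(d(d(d(s(c)))))), d(c)→c, d(s(x))→s(s(d(x))). *)

theory Defs
  imports Complex_Main
begin

datatype ('f, 'v) trm = Var 'v | Fun 'f "('f, 'v) trm list"

type_synonym ('f, 'v) trs = "(('f, 'v) trm \<times> ('f, 'v) trm) set"

text \<open>A signature is a set \<open>F\<close> of symbols together with an arity function \<open>ar\<close>;
  \<open>wf_trm F ar t\<close> says that \<open>t\<close> is a term over it.\<close>

fun wf_trm :: "'f set \<Rightarrow> ('f \<Rightarrow> nat) \<Rightarrow> ('f, 'v) trm \<Rightarrow> bool" where
  "wf_trm F ar (Var x) = True"
| "wf_trm F ar (Fun f ts) = (f \<in> F \<and> length ts = ar f \<and> (\<forall>t\<in>set ts. wf_trm F ar t))"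

fun vars_list :: "('f, 'v) trm \<Rightarrow> 'v list" where
  "vars_list (Var x) = [x]"
| "vars_list (Fun f ts) = concat (map vars_list ts)"

definition vars :: "('f, 'v) trm \<Rightarrow> 'v set" where
  "vars t = set (vars_list t)"

fun subterms :: "('f, 'v) trm \<Rightarrow> ('f, 'v) trm set" where
  "subterms (Var x) = {Var x}"
| "subterms (Fun f ts) = insert (Fun f ts) (\<Union>t\<in>set ts. subterms t)"

fun subst :: "('v \<Rightarrow> ('f, 'v) trm) \<Rightarrow> ('f, 'v) trm \<Rightarrow> ('f, 'v) trm" where
  "subst \<sigma> (Var x) = \<sigma> x"
| "subst \<sigma> (Fun f ts) = Fun f (map (subst \<sigma>) ts)"

definition is_value :: "'f set \<Rightarrow> ('f \<Rightarrow> nat) \<Rightarrow> ('f, 'v) trm \<Rightarrow> bool" where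
  "is_value C ar t \<longleftrightarrow> wf_trm C ar t \<and> vars t = {}"

inductive rstep :: "('f, 'v) trs \<Rightarrow> ('f, 'v) trm \<Rightarrow> ('f, 'v) trm \<Rightarrow> bool" for R where
  root: "(l, r) \<in> R \<Longrightarrow> rstep R (subst \<sigma> l) (subst \<sigma> r)"
| arg: "rstep R s t \<Longrightarrow> rstep R (Fun f (us @ s # vs)) (Fun f (us @ t # vs))"

definition constructor_trs ::
  "'f set \<Rightarrow> 'f set \<Rightarrow> ('f \<Rightarrow> nat) \<Rightarrow> ('f, 'v) trs \<Rightarrow> bool" where
  "constructor_trs C D ar R \<longleftrightarrow>
     C \<inter> D = {} \<and> finite R \<and>
     (\<forall>(l, r)\<in>R.
        (\<exists>f ts. l = Fun f ts \<and> f \<in> D \<and> length ts = ar f \<and> (\<forall>t\<in>set ts. wf_trm C ar t)) \<and>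
        wf_trm (C \<union> D) ar r \<and> vars r \<subseteq> vars l)"

definition left_linear :: "('f, 'v) trs \<Rightarrow> bool" where
  "left_linear R \<longleftrightarrow> (\<forall>(l, r)\<in>R. distinct (vars_list l))"

text \<open>Absence of critical pairs. Using two independent substitutions amounts to renaming
  the two rules apart; the only overlap permitted is that of a rule with itself at the root.\<close>

definition non_overlapping :: "('f, 'v) trs \<Rightarrow> bool" where
  "non_overlapping R \<longleftrightarrow>
     (\<forall>(l1, r1)\<in>R. \<forall>(l2, r2)\<in>R. \<forall>u\<in>subterms l2. \<forall>\<sigma> \<tau>.
        (\<forall>x. u \<noteq> Var x) \<longrightarrow> subst \<sigma> l1 = subst \<tau> u \<longrightarrow> u = l2 \<and> (l1, r1) = (l2, r2))"

definition orthogonal :: "('f, 'v) trs \<Rightarrow> bool" where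
  "orthogonal R \<longleftrightarrow> left_linear R \<and> non_overlapping R"

definition terminating ::
  "'f set \<Rightarrow> 'f set \<Rightarrow> ('f \<Rightarrow> nat) \<Rightarrow> ('f, 'v) trs \<Rightarrow> bool" where
  "terminating C D ar R \<longleftrightarrow>
     \<not> (\<exists>s :: nat \<Rightarrow> ('f, 'v) trm. \<forall>i. wf_trm (C \<union> D) ar (s i) \<and> rstep R (s i) (s (Suc i)))"

text \<open>The size of a term is its number of occurrences of symbols and variables, where
  constants of \<open>C\<close> do not count. This is the normalisation that additive assignments use for
  them, so that a value has the size given by the assignment whose offsets
  \<open>k\<^sub>c\<close> are all 1. It is essential: if constants of \<open>C\<close> had size 1, the bound on the
  runtime complexity in \<open>rc_assignment\<close> would be too small. With the single rule
  \<open>f(c) \<rightarrow> s(s(c))\<close>, the term \<open>f(c)\<close> would get the value \<open>1 * 5 ^ rc 1 = 1\<close>, as there would be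
  no basic term of size at most 1, whereas its normal form \<open>s(s(c))\<close> gets the value 2.\<close>

fun tsize :: "'f set \<Rightarrow> ('f, 'v) trm \<Rightarrow> nat" where
  "tsize C (Var x) = 1"
| "tsize C (Fun f ts) = (if f \<in> C \<and> ts = [] then 0 else 1) + sum_list (map (tsize C) ts)"

definition trs_size :: "'f set \<Rightarrow> ('f, 'v) trs \<Rightarrow> nat" where
  "trs_size C R = (\<Sum>(l, r)\<in>R. tsize C l + tsize C r)"

text \<open>On \<open>nat\<close>, \<open>Sup\<close> is the maximum of a nonempty bounded set, and \<open>Sup {} = 0\<close>.\<close>

definition dl :: "('f, 'v) trs \<Rightarrow> ('f, 'v) trm \<Rightarrow> nat" where
  "dl R t = Sup {n. \<exists>s. (rstep R ^^ n) t s}"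

definition basic :: "'f set \<Rightarrow> 'f set \<Rightarrow> ('f \<Rightarrow> nat) \<Rightarrow> ('f, 'v) trm \<Rightarrow> bool" where
  "basic C D ar t \<longleftrightarrow>
     (\<exists>f vs. t = Fun f vs \<and> f \<in> D \<and> length vs = ar f \<and> (\<forall>v\<in>set vs. is_value C ar v))"

definition rc ::
  "'f set \<Rightarrow> 'f set \<Rightarrow> ('f \<Rightarrow> nat) \<Rightarrow> ('f, 'v) trs \<Rightarrow> nat \<Rightarrow> nat" where
  "rc C D ar R n = Sup {dl R t | t. basic C D ar t \<and> tsize C t \<le> n}"

text \<open>An assignment maps a symbol of arity \<open>m\<close> to a function on lists of length \<open>m\<close>; its
  results on lists of other lengths are irrelevant.\<close>

type_synonym 'f assignment = "'f \<Rightarrow> nat list \<Rightarrow> nat"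

fun extend :: "'f assignment \<Rightarrow> ('v \<Rightarrow> nat) \<Rightarrow> ('f, 'v) trm \<Rightarrow> nat" where
  "extend \<theta> \<alpha> (Var x) = \<alpha> x"
| "extend \<theta> \<alpha> (Fun f ts) = \<theta> f (map (extend \<theta> \<alpha>) ts)"

text \<open>The graph of the partial function computed by \<open>f\<close>: the value of \<open>f\<close> at \<open>vs\<close> is
  defined iff \<open>computes C ar R f vs v\<close> for some \<open>v\<close>.\<close>

definition computes ::
  "'f set \<Rightarrow> ('f \<Rightarrow> nat) \<Rightarrow> ('f, 'v) trs \<Rightarrow> 'f \<Rightarrow> ('f, 'v) trm list \<Rightarrow> ('f, 'v) trm \<Rightarrow> bool"
where
  "computes C ar R f vs v \<longleftrightarrow> (rstep R)\<^sup>*\<^sup>* (Fun f vs) v \<and> is_value C ar v"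

definition nondecreasing :: "'f set \<Rightarrow> ('f \<Rightarrow> nat) \<Rightarrow> 'f assignment \<Rightarrow> bool" where
  "nondecreasing F ar \<theta> \<longleftrightarrow>
     (\<forall>f\<in>F. \<forall>xs i y. length xs = ar f \<longrightarrow> i < ar f \<longrightarrow> xs ! i \<le> y \<longrightarrow>
        \<theta> f xs \<le> \<theta> f (xs[i := y]))"

definition additive :: "'f set \<Rightarrow> ('f \<Rightarrow> nat) \<Rightarrow> 'f assignment \<Rightarrow> bool" where
  "additive C ar \<theta> \<longleftrightarrow>
     (\<forall>c\<in>C. if ar c = 0 then \<theta> c [] = 0
        else \<exists>k\<ge>1. \<forall>xs. length xs = ar c \<longrightarrow> \<theta> c xs = sum_list xs + k)"

definition sup_interpretation ::
  "'f set \<Rightarrow> 'f set \<Rightarrow> ('f \<Rightarrow> nat) \<Rightarrow> ('f, 'v) trs \<Rightarrow> 'f assignment \<Rightarrow> bool" where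
  "sup_interpretation C D ar R \<theta> \<longleftrightarrow>
     nondecreasing (C \<union> D) ar \<theta> \<and> additive C ar \<theta> \<and>
     (\<forall>f\<in>D. \<forall>vs v \<alpha>. length vs = ar f \<longrightarrow> (\<forall>u\<in>set vs. is_value C ar u) \<longrightarrow>
        computes C ar R f vs v \<longrightarrow> extend \<theta> \<alpha> (Fun f vs) \<ge> extend \<theta> \<alpha> v)"

definition rc_assignment ::
  "'f set \<Rightarrow> 'f set \<Rightarrow> ('f \<Rightarrow> nat) \<Rightarrow> ('f, 'v) trs \<Rightarrow> 'f assignment" where
  "rc_assignment C D ar R f xs =
     (if f \<in> C then (if ar f = 0 then 0 else sum_list xs + 1)
      else (sum_list xs + 1) * trs_size C R ^ rc C D ar R (sum_list xs + 1))"

end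

theory Submission
  imports Defs
begin

text \<open>One step multiplies the size of a term by at most \<open>|R|\<close>, so a value reached from a
  basic term \<open>t\<close> in \<open>n\<close> steps has size at most \<open>|t| * |R| ^ n\<close>, and \<open>n\<close> is at most
  \<open>rc |t|\<close> provided that the suprema in \<open>dl\<close> and \<open>rc\<close> are taken over bounded sets. For \<open>dl\<close> this
  is Koenig's lemma. For \<open>rc\<close> there may be infinitely many basic terms of a given size, since the
  signature may be infinite. Replacing all subterms headed by a symbol that does not occur in \<open>R\<close> by
  one variable preserves derivations from basic terms and leaves only finitely many terms of
  each size.\<close>

section \<open>Substitution and term size\<close>

lemma vars_simps [simp]:
  "vars (Var x) = {x}"
  "vars (Fun f ts) = (\<Union>t\<in>set ts. vars t)"
  by (simp_all add: vars_def)

lemma subst_cong: "(\<And>x. x \<in> vars t \<Longrightarrow> \<sigma> x = \<tau> x) \<Longrightarrow> subst \<sigma> t = subst \<tau> t"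
  by (induction t) auto

lemma subst_eq_imp_eq_on_vars: "subst \<sigma> t = subst \<tau> t \<Longrightarrow> x \<in> vars t \<Longrightarrow> \<sigma> x = \<tau> x"
  by (induction t) auto

lemma wf_trm_mono: "wf_trm F ar t \<Longrightarrow> F \<subseteq> G \<Longrightarrow> wf_trm G ar t"
  by (induction t) auto

lemma wf_trm_subst:
  assumes "wf_trm F ar t" "\<And>x. x \<in> vars t \<Longrightarrow> wf_trm F ar (\<sigma> x)"
  shows "wf_trm F ar (subst \<sigma> t)"
  using assms by (induction t) auto

lemma wf_trm_subst_vars: "wf_trm F ar (subst \<sigma> t) \<Longrightarrow> x \<in> vars t \<Longrightarrow> wf_trm F ar (\<sigma> x)"
  by (induction t) auto

lemma sum_list_map_le_mult:
  fixes f g :: "'a \<Rightarrow> nat"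
  assumes "\<And>x. x \<in> set xs \<Longrightarrow> f x \<le> g x * m"
  shows "sum_list (map f xs) \<le> sum_list (map g xs) * m"
  using assms
proof (induction xs)
  case (Cons a xs)
  then have "f a \<le> g a * m" "sum_list (map f xs) \<le> sum_list (map g xs) * m" by auto
  then show ?case by (simp add: algebra_simps)
qed simp

text \<open>A variable of size 1 grows to at most \<open>m\<close>, and \<open>m \<ge> 1\<close>
  lets each remaining symbol be charged \<open>m\<close> too.\<close>

lemma tsize_subst_le:
  assumes "m \<ge> 1" "\<And>x. x \<in> vars t \<Longrightarrow> tsize C (\<sigma> x) \<le> m"
  shows "tsize C (subst \<sigma> t) \<le> tsize C t * m"
  using assms(2)
proof (induction t)
  case (Fun f ts)
  have "sum_list (map (\<lambda>t. tsize C (subst \<sigma> t)) ts) \<le> sum_list (map (tsize C) ts) * m"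
    using Fun by (intro sum_list_map_le_mult) auto
  with assms(1) show ?case by (auto simp: o_def add_mult_distrib intro: add_mono)
qed simp

lemma tsize_arg_le: "t \<in> set ts \<Longrightarrow> tsize C t \<le> sum_list (map (tsize C) ts)"
  by (rule member_le_sum_list) auto

lemma tsize_var_le_subst: "x \<in> vars t \<Longrightarrow> tsize C (\<sigma> x) \<le> tsize C (subst \<sigma> t)"
proof (induction t)
  case (Fun f ts)
  then obtain t where t: "t \<in> set ts" "x \<in> vars t" by auto
  then have "tsize C (\<sigma> x) \<le> tsize C (subst \<sigma> t)" using Fun by blast
  also have "\<dots> \<le> sum_list (map (tsize C) (map (subst \<sigma>) ts))"
    using t by (intro tsize_arg_le) simp
  finally show ?case by simp
qed simp

section \<open>Collapsing symbols foreign to the rules\<close>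

fun funs :: "('f, 'v) trm \<Rightarrow> 'f set" where
  "funs (Var x) = {}"
| "funs (Fun f ts) = insert f (\<Union>t\<in>set ts. funs t)"

lemma finite_funs: "finite (funs t)"
  by (induction t) auto

definition trs_funs :: "('f, 'v) trs \<Rightarrow> 'f set" where
  "trs_funs R = (\<Union>(l, r)\<in>R. funs l \<union> funs r)"

text \<open>Variables are identified as well, so that finiteness does not depend on the variable
  type.\<close>

fun collapse :: "'f set \<Rightarrow> ('f, 'v) trm \<Rightarrow> ('f, 'v) trm" where
  "collapse K (Var x) = Var undefined"
| "collapse K (Fun f ts) = (if f \<in> K then Fun f (map (collapse K) ts) else Var undefined)"

lemma collapse_subst:
  "funs t \<subseteq> K \<Longrightarrow> collapse K (subst \<sigma> t) = subst (\<lambda>x. collapse K (\<sigma> x)) t"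
  by (induction t) auto

lemma wf_trm_collapse: "wf_trm F ar t \<Longrightarrow> wf_trm F ar (collapse K t)"
  by (induction t) auto

text \<open>The condition under which collapsing loses no rewrite step.\<close>

fun collapsible :: "('f, 'v) trs \<Rightarrow> 'f set \<Rightarrow> ('f, 'v) trm \<Rightarrow> bool" where
  "collapsible R K (Var x) = True"
| "collapsible R K (Fun f ts) =
     (if f \<in> K then \<forall>t\<in>set ts. collapsible R K t else \<not> (\<exists>u. rstep R (Fun f ts) u))"

lemma collapsible_subst:
  "funs t \<subseteq> K \<Longrightarrow> collapsible R K (subst \<sigma> t) \<longleftrightarrow> (\<forall>x\<in>vars t. collapsible R K (\<sigma> x))"
  by (induction t) (auto simp: SUP_le_iff)

fun bounded_trms :: "'f set \<Rightarrow> ('f \<Rightarrow> nat) \<Rightarrow> nat \<Rightarrow> ('f, 'v) trm set" where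
  "bounded_trms K ar 0 = {Var undefined}"
| "bounded_trms K ar (Suc k) = insert (Var undefined)
     (\<Union>f\<in>K. Fun f ` {ts. set ts \<subseteq> bounded_trms K ar k \<and> length ts = ar f})"

lemma finite_bounded_trms: "finite K \<Longrightarrow> finite (bounded_trms K ar k)"
  by (induction k) (auto intro: finite_lists_length_eq)

text \<open>The index of \<open>bounded_trms\<close> bounds nesting depth. Every symbol on a path
  counts towards the size, except possibly a constant of \<open>C\<close> at its end; that one
  accounts for the \<open>Suc\<close>.\<close>

lemma collapse_in_bounded_trms:
  "wf_trm F ar t \<Longrightarrow> tsize C t \<le> k \<Longrightarrow> collapse K t \<in> bounded_trms K ar (Suc k)"
proof (induction t arbitrary: k)
  case (Fun f ts)
  have "collapse K t \<in> bounded_trms K ar k" if t: "t \<in> set ts" for t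
  proof -
    \<comment> \<open>Having an argument, \<open>f\<close> is not a constant and contributes
      1.\<close>
    have "tsize C t < k"
      using Fun.prems(2) tsize_arg_le[OF t, of C] t by (auto split: if_splits)
    then show ?thesis using Fun.IH[OF t, of "k - 1"] Fun.prems(1) t by simp
  qed
  then have "map (collapse K) ts \<in> {ts. set ts \<subseteq> bounded_trms K ar k \<and> length ts = ar f}"
    using Fun.prems(1) by auto
  then show ?case by (auto simp del: mem_Collect_eq)
qed simp

section \<open>Finite branching\<close>

text \<open>A redex determines the matching substitution on the variables of \<open>l\<close>, hence
  on those of \<open>r\<close>. So each rule has at most one contractum at each of the finitely many
  positions.\<close>

lemma finite_rsteps:
  fixes R :: "('f, 'v) trs"
  assumes fin: "finite R" and vars: "\<And>l r. (l, r) \<in> R \<Longrightarrow> vars r \<subseteq> vars l"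
  shows "finite {t. rstep R s t}"
proof -
  \<comment> \<open>If \<open>l\<close> does not match \<open>s\<close>, \<open>SOME\<close> yields
    an arbitrary substitution; this is harmless, as \<open>roots s\<close> only has to contain all
    root contracta.\<close>
  define roots :: "('f, 'v) trm \<Rightarrow> ('f, 'v) trm set"
    where "roots s = (\<lambda>(l, r). subst (SOME \<sigma>. subst \<sigma> l = s) r) ` R" for s
  have fin_roots: "finite (roots s)" for s
    unfolding roots_def using fin by simp
  have roots: "subst \<sigma> r \<in> roots (subst \<sigma> l)" if "(l, r) \<in> R" for \<sigma> l r
  proof -
    have "subst (SOME \<tau>. subst \<tau> l = subst \<sigma> l) l = subst \<sigma> l"
      by (rule someI[where P = "\<lambda>\<tau>. subst \<tau> l = subst \<sigma> l"]) (rule refl)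
    then have "subst (SOME \<tau>. subst \<tau> l = subst \<sigma> l) r = subst \<sigma> r"
      using vars[OF that] by (blast intro: subst_cong dest: subst_eq_imp_eq_on_vars)
    then show ?thesis unfolding roots_def using that by force
  qed
  show ?thesis
  proof (induction s)
    case (Var x)
    have "t \<in> roots (Var x)" if "rstep R (Var x) t" for t
      using that by cases (use roots in auto)
    then have "{t. rstep R (Var x) t} \<subseteq> roots (Var x)" by blast
    then show ?case using fin_roots finite_subset by blast
  next
    case (Fun f ts)
    let ?A = "\<Union>i<length ts. (\<lambda>t. Fun f (ts[i := t])) ` {t. rstep R (ts ! i) t}"
    have "t \<in> roots (Fun f ts) \<union> ?A" if "rstep R (Fun f ts) t" for t
      using that
    proof cases
      case (root l r \<sigma>)
      then show ?thesis using roots by auto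
    next
      case (arg s t' us vs)
      then have "t = Fun f (ts[length us := t'])" "rstep R (ts ! length us) t'"
        "length us < length ts" by auto
      then show ?thesis by blast
    qed
    then have "{t. rstep R (Fun f ts) t} \<subseteq> roots (Fun f ts) \<union> ?A" by blast
    moreover have "finite (roots (Fun f ts) \<union> ?A)" using fin_roots Fun by auto
    ultimately show ?case by (rule finite_subset)
  qed
qed

lemma rstep_imp_nonempty: "rstep R s t \<Longrightarrow> R \<noteq> {}"
  by (induction rule: rstep.induct) auto

text \<open>Sizes count constants of \<open>C\<close> as 0 and other constructors as 1, exactly the
  offsets of the assignment.\<close>

lemma extend_eq_tsize:
  assumes "\<And>c xs. c \<in> C \<Longrightarrow> length xs = ar c \<Longrightarrow> \<theta> c xs = (if ar c = 0 then 0 else sum_list xs + 1)"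
    and "is_value C ar v"
  shows "extend \<theta> \<alpha> v = tsize C v"
  using assms(2)
proof (induction v)
  case (Fun c vs)
  have "is_value C ar v" if "v \<in> set vs" for v
    using Fun.prems that by (auto simp: is_value_def)
  then have "map (extend \<theta> \<alpha>) vs = map (tsize C) vs" using Fun.IH by simp
  moreover have "c \<in> C" "length vs = ar c" using Fun.prems by (auto simp: is_value_def)
  moreover from this have "ar c = 0 \<longleftrightarrow> vs = []" by auto
  ultimately show ?case using assms(1)[of c "map (tsize C) vs"] by (auto simp del: map_eq_conv)
qed (simp add: is_value_def)

section \<open>Size growth in constructor systems\<close>

context
  fixes C D :: "'f set" and ar :: "'f \<Rightarrow> nat" and R :: "('f, 'v) trs"
  assumes ctrs: "constructor_trs C D ar R"
begin

lemma finite_rules: "finite R"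
  using ctrs by (auto simp: constructor_trs_def)

lemma disjoint_C_D: "f \<in> D \<Longrightarrow> f \<notin> C"
  using ctrs by (auto simp: constructor_trs_def)

lemma ruleE:
  assumes "(l, r) \<in> R"
  obtains f ts where "l = Fun f ts" "f \<in> D" "wf_trm (C \<union> D) ar r" "vars r \<subseteq> vars l"
  using assms ctrs unfolding constructor_trs_def by blast

lemma rstep_wf_trm: "rstep R s t \<Longrightarrow> wf_trm (C \<union> D) ar s \<Longrightarrow> wf_trm (C \<union> D) ar t"
proof (induction rule: rstep.induct)
  case (root l r \<sigma>)
  then show ?case by (elim ruleE) (blast intro: wf_trm_subst wf_trm_subst_vars)
qed auto

lemma rstep_not_constructor_trm: "rstep R s t \<Longrightarrow> \<not> wf_trm C ar s"
proof (induction rule: rstep.induct)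
  case (root l r \<sigma>)
  then show ?case using disjoint_C_D by (elim ruleE) auto
qed auto

lemma tsize_rule_le: "(l, r) \<in> R \<Longrightarrow> tsize C l + tsize C r \<le> trs_size C R"
  unfolding trs_size_def
  using member_le_sum[of "(l, r)" R "\<lambda>(l, r). tsize C l + tsize C r"] finite_rules by auto

lemma trs_size_pos: "R \<noteq> {} \<Longrightarrow> trs_size C R \<ge> 1"
proof -
  assume "R \<noteq> {}"
  then obtain l r where lr: "(l, r) \<in> R" by auto
  then have "tsize C l \<ge> 1" using disjoint_C_D by (elim ruleE) auto
  then show ?thesis using tsize_rule_le[OF lr] by simp
qed

text \<open>At the root, the contractum is \<open>r\<close> with terms no larger than the redex
  plugged in, and the size of \<open>r\<close> is at most \<open>trs_size C R\<close>. Below the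
  root, this factor is at least 1 and absorbs the context.\<close>

lemma rstep_tsize_le: "rstep R s t \<Longrightarrow> tsize C t \<le> tsize C s * trs_size C R"
proof (induction rule: rstep.induct)
  case (root l r \<sigma>)
  have "tsize C (subst \<sigma> l) \<ge> 1" using root disjoint_C_D by (elim ruleE) auto
  moreover have "tsize C (\<sigma> x) \<le> tsize C (subst \<sigma> l)" if "x \<in> vars r" for x
    using root that by (elim ruleE) (blast intro: tsize_var_le_subst)
  ultimately have "tsize C (subst \<sigma> r) \<le> tsize C r * tsize C (subst \<sigma> l)"
    by (rule tsize_subst_le)
  also have "\<dots> \<le> trs_size C R * tsize C (subst \<sigma> l)"
    using tsize_rule_le[OF root] by (intro mult_right_mono) auto
  finally show ?case by (simp add: mult.commute)
next
  case (arg s t f us vs)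
  then have K: "trs_size C R \<ge> 1" by (intro trs_size_pos rstep_imp_nonempty)
  \<comment> \<open>The size of the context; \<open>Suc\<close> counts \<open>f\<close>, which has
    an argument and so is no constant.\<close>
  define n where "n = Suc (sum_list (map (tsize C) us) + sum_list (map (tsize C) vs))"
  have "tsize C (Fun f (us @ t # vs)) = n + tsize C t" by (simp add: n_def)
  also have "\<dots> \<le> n * trs_size C R + tsize C s * trs_size C R"
    using arg.IH K by (intro add_mono) simp_all
  also have "\<dots> = tsize C (Fun f (us @ s # vs)) * trs_size C R"
    by (simp add: n_def algebra_simps)
  finally show ?case .
qed

lemma relpowp_rstep_tsize_le: "(rstep R ^^ n) s t \<Longrightarrow> tsize C t \<le> tsize C s * trs_size C R ^ n"
proof (induction n arbitrary: t)
  case (Suc n)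
  then obtain u where u: "(rstep R ^^ n) s u" "rstep R u t" by auto
  have "tsize C t \<le> tsize C u * trs_size C R" using u rstep_tsize_le by blast
  also have "\<dots> \<le> tsize C s * trs_size C R ^ n * trs_size C R"
    using Suc.IH[OF u(1)] by (rule mult_right_mono) simp
  finally show ?case by (simp add: algebra_simps)
qed simp

section \<open>Simulation of derivations on collapsed terms\<close>

lemma rstep_collapse:
  assumes "rstep R s t" "collapsible R (trs_funs R) s"
  shows "collapsible R (trs_funs R) t \<and>
    rstep R (collapse (trs_funs R) s) (collapse (trs_funs R) t)"
  using assms
proof (induction rule: rstep.induct)
  case (root l r \<sigma>)
  have "funs l \<subseteq> trs_funs R" "funs r \<subseteq> trs_funs R"
    using root(1) by (auto simp: trs_funs_def)
  moreover have "vars r \<subseteq> vars l" using root(1) by (rule ruleE)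
  ultimately show ?case
    using root by (auto simp: collapsible_subst collapse_subst intro: rstep.root)
next
  case (arg s t f us vs)
  \<comment> \<open>A collapsible term with a foreign head is irreducible, so the head of this
    reducible term survives collapsing.\<close>
  from arg.hyps have "rstep R (Fun f (us @ s # vs)) (Fun f (us @ t # vs))" by (rule rstep.arg)
  with arg.prems have "f \<in> trs_funs R" by (auto split: if_splits)
  with arg show ?case by (auto intro: rstep.arg)
qed

lemma relpowp_rstep_collapse:
  "(rstep R ^^ n) s t \<Longrightarrow> collapsible R (trs_funs R) s \<Longrightarrow>
     collapsible R (trs_funs R) t \<and>
     (rstep R ^^ n) (collapse (trs_funs R) s) (collapse (trs_funs R) t)"
proof (induction n arbitrary: t)
  case (Suc n)
  then show ?case using rstep_collapse by (fastforce intro: relcomppI)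
qed simp

lemma collapsible_constructor_trm: "wf_trm C ar t \<Longrightarrow> collapsible R K t"
proof (induction t)
  case (Fun f ts)
  then show ?case using rstep_not_constructor_trm[of "Fun f ts"] by auto
qed simp

text \<open>Values are irreducible, so a basic term can only be rewritten at the root, and then its
  head occurs in a left-hand side.\<close>

lemma collapsible_basic:
  assumes "basic C D ar t"
  shows "collapsible R (trs_funs R) t"
proof -
  from assms obtain f vs where t: "t = Fun f vs" and vs: "\<And>v. v \<in> set vs \<Longrightarrow> wf_trm C ar v"
    by (auto simp: basic_def is_value_def)
  have "f \<in> trs_funs R" if "rstep R (Fun f vs) u" for u
    using that
  proof cases
    case (root l r \<sigma>)
    then obtain ts where "l = Fun f ts" by (elim ruleE) auto
    then show ?thesis using root unfolding trs_funs_def by force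
  next
    case (arg s t' us ws)
    then show ?thesis using vs rstep_not_constructor_trm by auto
  qed
  then show ?thesis using t vs collapsible_constructor_trm by auto
qed

lemma basic_wf_trm: "basic C D ar t \<Longrightarrow> wf_trm (C \<union> D) ar t"
  using wf_trm_mono[of C ar _ "C \<union> D"] by (fastforce simp: basic_def is_value_def)

section \<open>Bounds on derivation lengths under termination\<close>

context
  assumes terminating: "terminating C D ar R"
begin

text \<open>Koenig's lemma as well-founded induction along rewriting: one more than the maximum of
  the bounds of the finitely many successors is a bound.\<close>

lemma derivation_length_bounded:
  assumes "wf_trm (C \<union> D) ar s"
  shows "\<exists>b. \<forall>n t. (rstep R ^^ n) s t \<longrightarrow> n \<le> b"
proof -
  have "wf {(t, s). wf_trm (C \<union> D) ar s \<and> rstep R s t}"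
    using terminating by (auto simp: wf_iff_no_infinite_down_chain terminating_def)
  then show ?thesis using assms
  proof (induction s rule: wf_induct_rule)
    case (less s)
    let ?S = "{t. rstep R s t}"
    have fin: "finite ?S"
      using finite_rules by (rule finite_rsteps) (erule ruleE)
    have "\<forall>u\<in>?S. \<exists>b. \<forall>n t. (rstep R ^^ n) u t \<longrightarrow> n \<le> b"
      using less rstep_wf_trm by auto
    then obtain b where b: "\<And>u n t. rstep R s u \<Longrightarrow> (rstep R ^^ n) u t \<Longrightarrow> n \<le> b u"
      unfolding bchoice_iff by blast
    have "n \<le> Suc (Max (insert 0 (b ` ?S)))" if "(rstep R ^^ n) s t" for n t
    proof (cases n)
      case (Suc m)
      from that obtain u where u: "rstep R s u" "(rstep R ^^ m) u t"
        unfolding Suc by (rule relpowp_Suc_E2)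
      then have "m \<le> b u" by (rule b)
      also have "b u \<le> Max (insert 0 (b ` ?S))" using fin u by (intro Max_ge) auto
      finally show ?thesis using Suc by simp
    qed simp
    then show ?case by blast
  qed
qed

lemma basic_derivation_length_bounded:
  "\<exists>b. \<forall>t k s. basic C D ar t \<longrightarrow> tsize C t \<le> n \<longrightarrow> (rstep R ^^ k) t s \<longrightarrow> k \<le> b"
proof -
  let ?K = "trs_funs R"
  \<comment> \<open>Collapsed terms may contain a variable and need not be basic; termination still
    covers them, since it concerns all well-formed terms, open ones included.\<close>
  let ?T = "{u \<in> bounded_trms ?K ar (Suc n). wf_trm (C \<union> D) ar u}"
  have "finite ?K"
    using finite_rules by (auto simp: trs_funs_def finite_funs)
  then have fin: "finite ?T"
    by (auto intro: finite_subset[OF _ finite_bounded_trms] simp del: bounded_trms.simps)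
  have "\<forall>u\<in>?T. \<exists>b. \<forall>k s. (rstep R ^^ k) u s \<longrightarrow> k \<le> b"
    using derivation_length_bounded by blast
  then obtain b where b: "\<And>u k s. u \<in> ?T \<Longrightarrow> (rstep R ^^ k) u s \<Longrightarrow> k \<le> b u"
    unfolding bchoice_iff by blast
  have "k \<le> Max (b ` ?T)"
    if t: "basic C D ar t" "tsize C t \<le> n" "(rstep R ^^ k) t s" for t k s
  proof -
    have "collapse ?K t \<in> ?T"
      using basic_wf_trm[OF t(1)] t(2) wf_trm_collapse collapse_in_bounded_trms by blast
    moreover have "(rstep R ^^ k) (collapse ?K t) (collapse ?K s)"
      using relpowp_rstep_collapse[OF t(3)] collapsible_basic[OF t(1)] by blast
    ultimately have "k \<le> b (collapse ?K t)" "b (collapse ?K t) \<le> Max (b ` ?T)"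
      using b fin by (blast, intro Max_ge) auto
    then show ?thesis by simp
  qed
  then show ?thesis by blast
qed

lemma bdd_above_dl:
  "basic C D ar t \<Longrightarrow> bdd_above {n. \<exists>s. (rstep R ^^ n) t s}"
  using basic_derivation_length_bounded[of "tsize C t"] unfolding bdd_above_def by blast

lemma bdd_above_rc: "bdd_above {dl R t | t. basic C D ar t \<and> tsize C t \<le> n}"
proof -
  obtain b where b: "\<And>t k s. basic C D ar t \<Longrightarrow> tsize C t \<le> n \<Longrightarrow> (rstep R ^^ k) t s \<Longrightarrow> k \<le> b"
    using basic_derivation_length_bounded by blast
  have "dl R t \<le> b" if "basic C D ar t" "tsize C t \<le> n" for t
    unfolding dl_def
  proof (rule cSup_least)
    have "(rstep R ^^ 0) t t" by simp
    then show "{n. \<exists>s. (rstep R ^^ n) t s} \<noteq> {}" by blast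
  qed (use b that in blast)
  then show ?thesis unfolding bdd_above_def by blast
qed

lemma derivation_length_le_rc:
  assumes "basic C D ar t" "(rstep R ^^ n) t s"
  shows "n \<le> rc C D ar R (tsize C t)"
proof -
  have "n \<le> dl R t"
    unfolding dl_def using assms by (intro cSup_upper bdd_above_dl) auto
  also have "\<dots> \<le> rc C D ar R (tsize C t)"
    unfolding rc_def using assms by (intro cSup_upper bdd_above_rc) auto
  finally show ?thesis .
qed

section \<open>Monotonicity of the runtime complexity\<close>

lemma rc_mono:
  assumes "m \<le> n"
  shows "rc C D ar R m \<le> rc C D ar R n"
proof (cases "{dl R t | t. basic C D ar t \<and> tsize C t \<le> m} = {}")
  \<comment> \<open>Without basic terms of size at most \<open>m\<close>, the left side is
    \<open>Sup {} = 0\<close>.\<close>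
  case True
  then show ?thesis by (simp add: rc_def del: Collect_empty_eq)
next
  case False
  then show ?thesis
    unfolding rc_def using assms by (intro cSup_subset_mono bdd_above_rc) auto
qed

lemma rc_empty_trs: "R = {} \<Longrightarrow> rc C D ar R n = 0"
proof -
  assume R: "R = {}"
  have "k = 0" if "(rstep R ^^ k) t s" for k t s
    using that R by (cases k) (auto dest: rstep_imp_nonempty)
  then have "{k. \<exists>s. (rstep R ^^ k) t s} = {0}" for t by force
  then have "dl R t = 0" for t by (simp add: dl_def)
  then have "{dl R t | t. basic C D ar t \<and> tsize C t \<le> n} \<subseteq> {0}" by auto
  \<comment> \<open>There may be no basic term this small; the supremum is 0 in either case.\<close>
  then consider "{dl R t | t. basic C D ar t \<and> tsize C t \<le> n} = {}"
    | "{dl R t | t. basic C D ar t \<and> tsize C t \<le> n} = {0}"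
    unfolding subset_singleton_iff by argo
  then show ?thesis by cases (simp_all add: rc_def del: Collect_empty_eq)
qed

text \<open>For \<open>R = {}\<close> the base is \<open>0\<close>, and monotonicity holds only because the exponent is
  constantly \<open>0\<close>.\<close>

lemma trs_size_power_rc_mono:
  assumes "m \<le> n"
  shows "trs_size C R ^ rc C D ar R m \<le> trs_size C R ^ rc C D ar R n"
proof (cases "R = {}")
  case True
  then show ?thesis using rc_empty_trs[OF True] by simp
next
  case False
  then show ?thesis using trs_size_pos rc_mono[OF assms] by (intro power_increasing) auto
qed

section \<open>Conditions of a sup-interpretation\<close>

lemma nondecreasing_rc_assignment:
  "nondecreasing (C \<union> D) ar (rc_assignment C D ar R)"
  unfolding nondecreasing_def
proof (intro ballI allI impI)
  fix f i y and xs :: "nat list"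
  assume "length xs = ar f" "i < ar f" "xs ! i \<le> y"
  then have "sum_list xs \<le> sum_list (xs[i := y])"
    by (simp add: sum_list_update)
  then show "rc_assignment C D ar R f xs \<le> rc_assignment C D ar R f (xs[i := y])"
    unfolding rc_assignment_def
    by (auto intro!: mult_mono add_mono trs_size_power_rc_mono)
qed

lemma additive_rc_assignment: "additive C ar (rc_assignment C D ar R)"
  by (auto simp: additive_def rc_assignment_def)

lemma rc_assignment_ge_value:
  assumes f: "f \<in> D" and len: "length vs = ar f" and vs: "\<And>u. u \<in> set vs \<Longrightarrow> is_value C ar u"
    and comp: "computes C ar R f vs v"
  shows "extend (rc_assignment C D ar R) \<alpha> v \<le> extend (rc_assignment C D ar R) \<alpha> (Fun f vs)"
proof -
  let ?\<theta> = "rc_assignment C D ar R" and ?t = "Fun f vs"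
  have ext: "extend ?\<theta> \<alpha> u = tsize C u" if "is_value C ar u" for u :: "('f, 'v) trm"
    using that by (intro extend_eq_tsize) (auto simp: rc_assignment_def)
  from comp obtain n where n: "(rstep R ^^ n) ?t v" and v: "is_value C ar v"
    by (auto simp: computes_def dest: rtranclp_imp_relpowp)
  \<comment> \<open>This makes the base of the power at least 1, so that the exponent may be raised.
    Without rules, \<open>?t\<close> would itself be the value \<open>v\<close>, although its head
    \<open>f\<close> is not a constructor.\<close>
  have "R \<noteq> {}"
  proof
    assume "R = {}"
    moreover have "basic C D ar ?t" using f len vs by (auto simp: basic_def)
    ultimately have "n = 0" using derivation_length_le_rc[OF _ n] rc_empty_trs by simp
    then show False using n v f disjoint_C_D by (auto simp: is_value_def)
  qed
  have "extend ?\<theta> \<alpha> v \<le> tsize C ?t * trs_size C R ^ n"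
    using ext[OF v] relpowp_rstep_tsize_le[OF n] by simp
  also have "\<dots> \<le> tsize C ?t * trs_size C R ^ rc C D ar R (tsize C ?t)"
    using derivation_length_le_rc[OF _ n] f len vs trs_size_pos[OF \<open>R \<noteq> {}\<close>]
    by (intro mult_left_mono power_increasing) (auto simp: basic_def)
  \<comment> \<open>As \<open>f\<close> is not in \<open>C\<close>, it counts 1 even if nullary, so
    the size of \<open>?t\<close> is the sum of the interpreted arguments plus 1.\<close>
  also have "\<dots> = extend ?\<theta> \<alpha> ?t"
  proof -
    have "map (extend ?\<theta> \<alpha>) vs = map (tsize C) vs" using ext vs by simp
    then show ?thesis
      using disjoint_C_D[OF f] by (simp add: rc_assignment_def del: map_eq_conv)
  qed
  finally show ?thesis .
qed

end

end

theorem theorem28: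
  fixes C D :: "'f set" and ar :: "'f \<Rightarrow> nat" and R :: "('f, 'v) trs"
  assumes "constructor_trs C D ar R"
    and "orthogonal R"
    and "terminating C D ar R"
  shows "sup_interpretation C D ar R (rc_assignment C D ar R)"
  unfolding sup_interpretation_def
  using nondecreasing_rc_assignment[OF assms(1,3)] additive_rc_assignment[OF assms(1,3)]
    rc_assignment_ge_value[OF assms(1,3)]
  by blast

end
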